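(* Let $\{\xi_k\}_{k\ge 0}$ be a sequence of centered Gaussian complex random variables on a probability space, $\xi_k=\eta_k+i\zeta_k$ with $\eta_k,\zeta_k$ real valued (the $\xi_k$ are not assumed independent of one another, and $\eta_k,\zeta_k$ may be dependent). Put $\sigma_k=\sqrt{\mathbf{E}\eta_k^2+\mathbf{E}\zeta_k^2}$. Let $R=R(\omega)$ denote the radius of convergence of the random power series $f(z)=\sum_{k=0}^\infty \xi_k z^k$, $z\in\mathbb{C}$. Then $R$ is almost surely non-random, and with probability one $$R=\frac{1}{\limsup_{n\to\infty}\sigma_n^{1/n}}.$$
   Context: A centered Gaussian complex random variable here means $\xi=\eta+i\zeta$ whose real and imaginary parts $\eta,\zeta$ are mean-zero real Gaussian random variables; $\eta$ and $\zeta$ may have different variances and may be dependent. Conventions: $1/0=\infty$ and $1/\infty=0$. *)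

theory Defs
  imports "HOL-Probability.Probability"
begin

text \<open>
  A mean-zero real Gaussian variable. As is usual, variance zero is allowed, so that for instance
  real-valued or partly vanishing coefficient sequences are covered. The library's
  \<open>normal_density\<close> describes a law only for positive standard deviation, hence the separate
  degenerate case.
\<close>

definition centered_gaussian :: "'a measure \<Rightarrow> ('a \<Rightarrow> real) \<Rightarrow> bool" where
  "centered_gaussian M X \<longleftrightarrow>
     X \<in> borel_measurable M \<and>
     ((\<exists>s>0. distributed M lborel X (normal_density 0 s)) \<or> (AE \<omega> in M. X \<omega> = 0))"

text \<open>
  Nothing is required of the joint law of the real and imaginary parts; in particular they
  need be neither independent nor identically distributed nor jointly Gaussian.
\<close>

definition centered_complex_gaussian :: "'a measure \<Rightarrow> ('a \<Rightarrow> complex) \<Rightarrow> bool" where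
  "centered_complex_gaussian M Z \<longleftrightarrow>
     centered_gaussian M (\<lambda>\<omega>. Re (Z \<omega>)) \<and> centered_gaussian M (\<lambda>\<omega>. Im (Z \<omega>))"

definition complex_std_dev :: "'a measure \<Rightarrow> ('a \<Rightarrow> complex) \<Rightarrow> real" where
  "complex_std_dev M Z =
     sqrt ((\<integral>\<omega>. (Re (Z \<omega>))\<^sup>2 \<partial>M) + (\<integral>\<omega>. (Im (Z \<omega>))\<^sup>2 \<partial>M))"

end

theory Submission
  imports Defs "HOL-Real_Asymp.Real_Asymp"
begin

text \<open>
  On the scale of \<open>n\<close>-th roots, each coefficient is asymptotically as large as its scale \<open>\<sigma>\<^sub>n\<close>.
  A centered Gaussian variable is rarely much larger than its standard deviation (Markov's
  inequality for the square) and rarely much smaller (its density is at most a constant over the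
  standard deviation). Allowing the polynomial factor \<open>t\<^sub>n = (n + 1)\<^sup>2\<close> in both directions, the
  probability that \<open>\<sigma>\<^sub>n / t\<^sub>n \<le> \<bar>\<xi>\<^sub>n\<bar> \<le> t\<^sub>n \<sigma>\<^sub>n\<close> fails is \<open>O(1 / t\<^sub>n)\<close>, which is summable. The
  convergence half of the Borel--Cantelli lemma, valid for arbitrarily dependent events, shows that
  almost surely these bounds hold for all large \<open>n\<close>. As \<open>t\<^sub>n\<close> has \<open>n\<close>-th root tending to 1, the
  \<open>n\<close>-th roots of \<open>\<bar>\<xi>\<^sub>n\<bar>\<close> and of \<open>\<sigma>\<^sub>n\<close> have the same upper limit. The Cauchy--Hadamard formula
  then gives the radius, and since the formula is deterministic, so is the radius.

  For the lower bound on \<open>\<bar>\<xi>\<^sub>n\<bar>\<close>, one of the real and imaginary parts carries at least half of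
  \<open>\<sigma>\<^sub>n\<^sup>2\<close>, and the modulus of that part bounds \<open>\<bar>\<xi>\<^sub>n\<bar>\<close> from below, whatever their joint law.
\<close>

section \<open>Concentration of a centered Gaussian variable around its scale\<close>

lemma (in prob_space) centered_gaussian_square_integrable:
  assumes "centered_gaussian M X"
  shows "integrable M (\<lambda>\<omega>. (X \<omega>)\<^sup>2)"
proof -
  have [measurable]: "X \<in> borel_measurable M"
    using assms by (simp add: centered_gaussian_def)
  consider s where "s > 0" "distributed M lborel X (normal_density 0 s)" | "AE \<omega> in M. X \<omega> = 0"
    using assms by (auto simp: centered_gaussian_def)
  then show ?thesis
  proof cases
    case 1
    have "integrable lborel (\<lambda>x. normal_density 0 s x * x\<^sup>2)"
      using integrable_normal_moment[of s 0 2] \<open>s > 0\<close> by simp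
    then show ?thesis
      using distributed_integrable[OF 1(2), of "\<lambda>x. x\<^sup>2"] by simp
  next
    case 2
    then have "AE \<omega> in M. (0::real) = (X \<omega>)\<^sup>2" by auto
    then have "integrable M (\<lambda>\<omega>. 0::real) \<longleftrightarrow> integrable M (\<lambda>\<omega>. (X \<omega>)\<^sup>2)"
      by (intro integrable_cong_AE) auto
    then show ?thesis by simp
  qed
qed

text \<open>
  The interval has length \<open>2 \<epsilon> s\<close> and the density of \<open>X\<close> is at most \<open>1 / (s \<surd>(2\<pi>))\<close>; the resulting
  constant \<open>2 / \<surd>(2\<pi>)\<close> is below 1. For a degenerate \<open>X\<close> the event is empty.
\<close>

lemma (in prob_space) centered_gaussian_small_ball:
  assumes "centered_gaussian M X" and "\<epsilon> \<ge> 0"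
  shows "prob {\<omega> \<in> space M. \<bar>X \<omega>\<bar> < \<epsilon> * sqrt (expectation (\<lambda>\<omega>. (X \<omega>)\<^sup>2))} \<le> \<epsilon>"
proof -
  have [measurable]: "X \<in> borel_measurable M"
    using assms by (simp add: centered_gaussian_def)
  consider s where "s > 0" "distributed M lborel X (normal_density 0 s)" | "AE \<omega> in M. X \<omega> = 0"
    using assms by (auto simp: centered_gaussian_def)
  then show ?thesis
  proof cases
    case 1
    have "expectation X = 0"
      using normal_distributed_expectation[OF 1(1,2)] .
    then have second_moment: "expectation (\<lambda>\<omega>. (X \<omega>)\<^sup>2) = s\<^sup>2"
      using normal_distributed_variance[OF 1(1,2)] by simp
    define I where "I = {- (\<epsilon> * s)<..<\<epsilon> * s}"
    define C where "C = 1 / (sqrt (2 * pi) * s)"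
    have "C \<ge> 0" using \<open>s > 0\<close> by (simp add: C_def)
    have density_le: "normal_density 0 s x \<le> C" for x
    proof -
      have "normal_density 0 s x = C * exp (- x\<^sup>2 / (2 * s\<^sup>2))"
        using \<open>s > 0\<close> by (simp add: normal_density_def C_def real_sqrt_mult)
      also have "\<dots> \<le> C * 1"
        using \<open>C \<ge> 0\<close> by (intro mult_left_mono) auto
      finally show ?thesis by simp
    qed
    have "emeasure M (X -` I \<inter> space M) = (\<integral>\<^sup>+x. ennreal (normal_density 0 s x) * indicator I x \<partial>lborel)"
      by (rule distributed_emeasure[OF 1(2)]) (simp add: I_def)
    also have "\<dots> \<le> (\<integral>\<^sup>+x. ennreal C * indicator I x \<partial>lborel)"
      by (intro nn_integral_mono mult_right_mono ennreal_leI density_le) simp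
    also have "\<dots> = ennreal C * emeasure lborel I"
      by (rule nn_integral_cmult_indicator) (simp add: I_def)
    also have "\<dots> = ennreal (C * (2 * (\<epsilon> * s)))"
      using \<open>\<epsilon> \<ge> 0\<close> \<open>s > 0\<close> \<open>C \<ge> 0\<close> by (simp add: I_def ennreal_mult)
    finally have "prob (X -` I \<inter> space M) \<le> C * (2 * (\<epsilon> * s))"
      using \<open>\<epsilon> \<ge> 0\<close> \<open>s > 0\<close> \<open>C \<ge> 0\<close> by (simp add: emeasure_eq_measure)
    also have "\<dots> = \<epsilon> * (2 / sqrt (2 * pi))"
      using \<open>s > 0\<close> by (simp add: C_def)
    also have "\<dots> \<le> \<epsilon> * 1"
    proof (intro mult_left_mono \<open>\<epsilon> \<ge> 0\<close>)
      have "2 \<le> sqrt (2 * pi)"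
        using pi_ge_two by (intro real_le_rsqrt) simp
      then show "2 / sqrt (2 * pi) \<le> 1" by simp
    qed
    also have "X -` I \<inter> space M = {\<omega> \<in> space M. \<bar>X \<omega>\<bar> < \<epsilon> * s}"
      by (auto simp: I_def abs_less_iff)
    finally show ?thesis
      using \<open>s > 0\<close> by (simp add: second_moment)
  next
    case 2
    then have "expectation (\<lambda>\<omega>. (X \<omega>)\<^sup>2) = expectation (\<lambda>\<omega>. 0)"
      by (intro integral_cong_AE) auto
    then show ?thesis
      using \<open>\<epsilon> \<ge> 0\<close> by simp
  qed
qed

lemma centered_complex_gaussian_measurable:
  assumes "centered_complex_gaussian M Z"
  shows "Z \<in> borel_measurable M"
  using assms
  by (simp add: centered_complex_gaussian_def centered_gaussian_def borel_measurable_complex_iff)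

text \<open>
  Markov's inequality for \<open>\<bar>Z\<bar>\<^sup>2\<close>, whose expectation is \<open>\<sigma>\<^sup>2\<close>. It needs a positive threshold, but
  when \<open>\<sigma> = 0\<close> the variable \<open>Z\<close> vanishes almost surely.
\<close>

lemma (in prob_space) centered_complex_gaussian_large_deviation:
  assumes Z: "centered_complex_gaussian M Z" and "t > 0"
  shows "prob {\<omega> \<in> space M. norm (Z \<omega>) > t * complex_std_dev M Z} \<le> 1 / t\<^sup>2"
proof -
  define \<sigma> where "\<sigma> = complex_std_dev M Z"
  have [measurable]: "Z \<in> borel_measurable M"
    using Z by (rule centered_complex_gaussian_measurable)
  have int_parts: "integrable M (\<lambda>\<omega>. (Re (Z \<omega>))\<^sup>2)" "integrable M (\<lambda>\<omega>. (Im (Z \<omega>))\<^sup>2)"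
    using Z centered_gaussian_square_integrable by (auto simp: centered_complex_gaussian_def)
  then have int: "integrable M (\<lambda>\<omega>. (norm (Z \<omega>))\<^sup>2)"
    by (simp add: cmod_power2)
  have "\<sigma> \<ge> 0"
    by (simp add: \<sigma>_def complex_std_dev_def)
  have \<sigma>_sq: "expectation (\<lambda>\<omega>. (norm (Z \<omega>))\<^sup>2) = \<sigma>\<^sup>2"
    using int_parts by (simp add: \<sigma>_def complex_std_dev_def cmod_power2)
  show ?thesis
  proof (cases "\<sigma> = 0")
    case True
    then have "AE \<omega> in M. (norm (Z \<omega>))\<^sup>2 = 0"
      using \<sigma>_sq integral_nonneg_eq_0_iff_AE[OF int] by simp
    then have "prob {\<omega> \<in> space M. norm (Z \<omega>) > t * \<sigma>} = 0"
      using True by (subst prob_eq_0) auto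
    then show ?thesis by (simp add: \<sigma>_def)
  next
    case False
    have "prob {\<omega> \<in> space M. norm (Z \<omega>) > t * \<sigma>}
        \<le> prob {\<omega> \<in> space M. (norm (Z \<omega>))\<^sup>2 \<ge> (t * \<sigma>)\<^sup>2}"
      using \<open>t > 0\<close> \<open>\<sigma> \<ge> 0\<close> by (intro finite_measure_mono) (auto intro!: power_mono)
    also have "\<dots> \<le> expectation (\<lambda>\<omega>. (norm (Z \<omega>))\<^sup>2) / (t * \<sigma>)\<^sup>2"
      using False \<open>t > 0\<close> by (intro integral_Markov_inequality_measure[where A = "{}"] int) auto
    also have "\<dots> = 1 / t\<^sup>2"
      using False by (simp add: \<sigma>_sq power_mult_distrib)
    finally show ?thesis by (simp add: \<sigma>_def)
  qed
qed

text \<open>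
  One of the two parts has standard deviation \<open>s\<close> with \<open>\<sigma> \<le> \<surd>2 s\<close>, and the small ball estimate
  for that part alone suffices. The constant \<open>\<surd>2\<close> is rounded up to 2.
\<close>

lemma (in prob_space) centered_complex_gaussian_small_ball:
  assumes Z: "centered_complex_gaussian M Z" and "\<epsilon> \<ge> 0"
  shows "prob {\<omega> \<in> space M. norm (Z \<omega>) < \<epsilon> * complex_std_dev M Z} \<le> 2 * \<epsilon>"
proof -
  define \<sigma> where "\<sigma> = complex_std_dev M Z"
  have [measurable]: "Z \<in> borel_measurable M"
    using Z by (rule centered_complex_gaussian_measurable)
  have from_part: "prob {\<omega> \<in> space M. norm (Z \<omega>) < \<epsilon> * \<sigma>} \<le> 2 * \<epsilon>"
    if X: "centered_gaussian M X" and X_le: "\<And>\<omega>. \<bar>X \<omega>\<bar> \<le> norm (Z \<omega>)"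
      and dominant: "\<sigma> \<le> 2 * sqrt (expectation (\<lambda>\<omega>. (X \<omega>)\<^sup>2))" for X
  proof -
    have [measurable]: "X \<in> borel_measurable M"
      using X by (simp add: centered_gaussian_def)
    have "\<epsilon> * \<sigma> \<le> 2 * \<epsilon> * sqrt (expectation (\<lambda>\<omega>. (X \<omega>)\<^sup>2))"
      using mult_left_mono[OF dominant \<open>\<epsilon> \<ge> 0\<close>] by (simp add: mult_ac)
    then have "prob {\<omega> \<in> space M. norm (Z \<omega>) < \<epsilon> * \<sigma>}
        \<le> prob {\<omega> \<in> space M. \<bar>X \<omega>\<bar> < 2 * \<epsilon> * sqrt (expectation (\<lambda>\<omega>. (X \<omega>)\<^sup>2))}"
      using X_le by (intro finite_measure_mono) (auto intro: le_less_trans less_le_trans)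
    also have "\<dots> \<le> 2 * \<epsilon>"
      using X \<open>\<epsilon> \<ge> 0\<close> by (intro centered_gaussian_small_ball) auto
    finally show ?thesis .
  qed
  define v where "v = expectation (\<lambda>\<omega>. (Re (Z \<omega>))\<^sup>2)"
  define w where "w = expectation (\<lambda>\<omega>. (Im (Z \<omega>))\<^sup>2)"
  have "v \<ge> 0" "w \<ge> 0"
    by (simp_all add: v_def w_def)
  have \<sigma>: "\<sigma> = sqrt (v + w)"
    by (simp add: \<sigma>_def complex_std_dev_def v_def w_def)
  have \<sigma>_le: "\<sigma> \<le> 2 * sqrt u" if "v + w \<le> 2 * u" "u \<ge> 0" for u
  proof -
    have "sqrt (v + w) \<le> sqrt (4 * u)"
      using that by (intro real_sqrt_le_mono) simp
    then show ?thesis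
      by (simp add: \<sigma> real_sqrt_mult)
  qed
  show ?thesis
  proof (cases "w \<le> v")
    case True
    then show ?thesis
      using from_part[of "\<lambda>\<omega>. Re (Z \<omega>)"] \<sigma>_le[of v] Z \<open>v \<ge> 0\<close>
      by (simp add: centered_complex_gaussian_def abs_Re_le_cmod v_def \<sigma>_def)
  next
    case False
    then show ?thesis
      using from_part[of "\<lambda>\<omega>. Im (Z \<omega>)"] \<sigma>_le[of w] Z \<open>w \<ge> 0\<close>
      by (simp add: centered_complex_gaussian_def abs_Im_le_cmod w_def \<sigma>_def)
  qed
qed

section \<open>Almost sure two-sided bounds for the coefficients\<close>

text \<open>
  This is the Borel--Cantelli lemma. The small ball probability decays only like the reciprocal of
  the factor allowed, so a linear factor would not give a summable series; \<open>(n + 1)\<^sup>2\<close> does, and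
  its \<open>n\<close>-th root still tends to 1.
\<close>

lemma (in prob_space) AE_centered_complex_gaussian_bounds:
  assumes \<xi>: "\<And>k. centered_complex_gaussian M (\<xi> k)"
  shows "AE \<omega> in M. \<forall>\<^sub>F n in sequentially.
    norm (\<xi> n \<omega>) \<le> real ((n + 1)\<^sup>2) * complex_std_dev M (\<xi> n) \<and>
    complex_std_dev M (\<xi> n) \<le> real ((n + 1)\<^sup>2) * norm (\<xi> n \<omega>)"
proof -
  define t :: "nat \<Rightarrow> real" where "t n = real ((n + 1)\<^sup>2)" for n
  define \<sigma> where "\<sigma> n = complex_std_dev M (\<xi> n)" for n
  have t_ge_1: "t n \<ge> 1" for n
    unfolding t_def by (subst of_nat_power, rule one_le_power) simp
  have [measurable]: "\<xi> n \<in> borel_measurable M" for n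
    using \<xi> by (rule centered_complex_gaussian_measurable)
  define Large where "Large n = {\<omega> \<in> space M. norm (\<xi> n \<omega>) > t n * \<sigma> n}" for n
  define Small where "Small n = {\<omega> \<in> space M. norm (\<xi> n \<omega>) < 1 / t n * \<sigma> n}" for n
  have [measurable]: "Large n \<in> sets M" "Small n \<in> sets M" for n
    unfolding Large_def Small_def by measurable
  have summable_inverse_t: "summable (\<lambda>n. 3 / t n)"
  proof -
    have "summable (\<lambda>n. inverse (real (Suc n) ^ 2))"
      using inverse_power_summable[of 2, where 'a = real] by (subst summable_Suc_iff) simp
    from summable_mult[OF this, of 3] show ?thesis
      by (simp add: t_def field_simps)
  qed
  have "prob (Large n \<union> Small n) \<le> 3 / t n" for n
  proof -
    have "prob (Large n) \<le> 1 / (t n)\<^sup>2"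
      unfolding Large_def \<sigma>_def using \<xi> t_ge_1[of n]
      by (intro centered_complex_gaussian_large_deviation) auto
    also have "\<dots> \<le> 1 / t n"
      using t_ge_1[of n] by (simp add: power2_eq_square field_simps)
    finally have "prob (Large n) \<le> 1 / t n" .
    moreover have "prob (Small n) \<le> 2 * (1 / t n)"
      unfolding Small_def \<sigma>_def using \<xi> t_ge_1[of n]
      by (intro centered_complex_gaussian_small_ball) auto
    moreover have "prob (Large n \<union> Small n) \<le> prob (Large n) + prob (Small n)"
      by (rule measure_Un_le) auto
    ultimately show ?thesis by simp
  qed
  then have "summable (\<lambda>n. prob (Large n \<union> Small n))"
    by (intro summable_comparison_test'[OF summable_inverse_t, of 0]) auto
  then have "AE \<omega> in M. \<forall>\<^sub>F n in sequentially. \<omega> \<in> space M - (Large n \<union> Small n)"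
    by (intro borel_cantelli_AE1) (auto simp: emeasure_eq_measure)
  then show ?thesis
  proof (rule AE_mp, intro AE_I2 impI)
    fix \<omega>
    assume "\<forall>\<^sub>F n in sequentially. \<omega> \<in> space M - (Large n \<union> Small n)"
    then show "\<forall>\<^sub>F n in sequentially.
        norm (\<xi> n \<omega>) \<le> real ((n + 1)\<^sup>2) * complex_std_dev M (\<xi> n) \<and>
        complex_std_dev M (\<xi> n) \<le> real ((n + 1)\<^sup>2) * norm (\<xi> n \<omega>)"
    proof eventually_elim
      case (elim n)
      then have "norm (\<xi> n \<omega>) \<le> t n * \<sigma> n" "1 / t n * \<sigma> n \<le> norm (\<xi> n \<omega>)"
        by (auto simp: Large_def Small_def not_less)
      then show ?case
        unfolding t_def[symmetric] \<sigma>_def[symmetric] using t_ge_1[of n] by (simp add: field_simps)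
    qed
  qed
qed

section \<open>Upper limits of n-th roots\<close>

text \<open>
  The \<open>n\<close>-th root is multiplicative, and a factor tending to 1 can be pulled out of an upper limit,
  even an infinite one.
\<close>

lemma limsup_root_mono_subexponential:
  fixes a b t :: "nat \<Rightarrow> real"
  assumes t: "(\<lambda>n. root n (t n)) \<longlonglongrightarrow> 1" and le: "\<forall>\<^sub>F n in sequentially. a n \<le> t n * b n"
  shows "limsup (\<lambda>n. ereal (root n (a n))) \<le> limsup (\<lambda>n. ereal (root n (b n)))"
proof -
  have "limsup (\<lambda>n. ereal (root n (a n)))
      \<le> limsup (\<lambda>n. ereal (root n (t n)) * ereal (root n (b n)))"
  proof (rule Limsup_mono)
    show "\<forall>\<^sub>F n in sequentially. ereal (root n (a n)) \<le> ereal (root n (t n)) * ereal (root n (b n))"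
      using le eventually_gt_at_top[of 0]
      by eventually_elim (simp flip: real_root_mult)
  qed
  also have "\<dots> = 1 * limsup (\<lambda>n. ereal (root n (b n)))"
    by (rule ereal_limsup_lim_mult) (use t in \<open>auto simp: one_ereal_def\<close>)
  finally show ?thesis by simp
qed

lemma root_square_Suc_tendsto_1: "(\<lambda>n. root n (real ((n + 1)\<^sup>2))) \<longlonglongrightarrow> 1"
proof (rule Lim_transform_eventually)
  show "(\<lambda>n. exp (2 * ln (real n + 1) / real n)) \<longlonglongrightarrow> 1"
    by real_asymp
  show "\<forall>\<^sub>F n in sequentially. exp (2 * ln (real n + 1) / real n) = root n (real ((n + 1)\<^sup>2))"
    using eventually_gt_at_top[of 0]
  proof eventually_elim
    case (elim n)
    have "ln (real ((n + 1)\<^sup>2)) = 2 * ln (real n + 1)"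
      by (simp add: ln_realpow add.commute)
    moreover have "root n (real ((n + 1)\<^sup>2)) = exp (ln (real ((n + 1)\<^sup>2)) / real n)"
      using elim by (simp add: root_powr_inverse powr_def)
    ultimately show ?case by simp
  qed
qed

section \<open>The radius of convergence\<close>

theorem theorem2p1:
  fixes M :: "'a measure" and \<xi> :: "nat \<Rightarrow> 'a \<Rightarrow> complex"
  assumes "prob_space M"
    and "\<And>k. centered_complex_gaussian M (\<xi> k)"
  shows "(\<exists>r. AE \<omega> in M. conv_radius (\<lambda>k. \<xi> k \<omega>) = r) \<and>
         (AE \<omega> in M. conv_radius (\<lambda>k. \<xi> k \<omega>) =
            1 / limsup (\<lambda>n. ereal (root n (complex_std_dev M (\<xi> n)))))"
proof -
  interpret prob_space M by fact
  have "AE \<omega> in M. conv_radius (\<lambda>k. \<xi> k \<omega>) =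
      1 / limsup (\<lambda>n. ereal (root n (complex_std_dev M (\<xi> n))))"
    using AE_centered_complex_gaussian_bounds[of \<xi>, OF assms(2)]
  proof (rule AE_mp, intro AE_I2 impI)
    fix \<omega>
    assume bounds: "\<forall>\<^sub>F n in sequentially.
      norm (\<xi> n \<omega>) \<le> real ((n + 1)\<^sup>2) * complex_std_dev M (\<xi> n) \<and>
      complex_std_dev M (\<xi> n) \<le> real ((n + 1)\<^sup>2) * norm (\<xi> n \<omega>)"
    have "limsup (\<lambda>n. ereal (root n (norm (\<xi> n \<omega>)))) =
        limsup (\<lambda>n. ereal (root n (complex_std_dev M (\<xi> n))))"
      by (intro antisym limsup_root_mono_subexponential[OF root_square_Suc_tendsto_1]
            eventually_mono[OF bounds]) auto
    then show "conv_radius (\<lambda>k. \<xi> k \<omega>) =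
        1 / limsup (\<lambda>n. ereal (root n (complex_std_dev M (\<xi> n))))"
      by (simp add: conv_radius_def divide_ereal_def)
  qed
  then show ?thesis by blast
qed

end
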